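(* Let $\mathbf{d}$ be a distance on a set $X$. The following are equivalent. (1) $X$ is a $\mathbf{d}$-$\max$-predomain. (2) There exist a set $X'\supseteq X$ and a distance $\mathbf{d}'$ on $X'$ with $\mathbf{d}'|_X=\mathbf{d}$ such that $X'$ is a $\mathbf{d}'$-$\max$-domain and $X$ is a $\mathbf{d}'$-$\max$-basis of $X'$.
   Context: Suprema and infima are taken in $[0,\infty]$, with $\sup\emptyset=0$, $\inf\emptyset=\infty$; for $a,b\in[0,\infty]$, $(a-b)_+=\min\{c\in[0,\infty]:a\leq b+c\}$. A distance on $X$ is a function $\mathbf{d}:X\times X\to[0,\infty]$, written $x\mathbf{d}y$, with $x\mathbf{d}z\leq x\mathbf{d}y+y\mathbf{d}z$ for all $x,y,z$ (no symmetry, and $x\mathbf{d}x=0$ is not required). Functions are ordered pointwise. The upper and lower hemimetrics are $x\overline{\mathbf{d}}z=\sup_{y\in X}(x\mathbf{d}y-z\mathbf{d}y)_+$ and $z\underline{\mathbf{d}}y=\sup_{x\in X}(x\mathbf{d}y-x\mathbf{d}z)_+$. $\mathbf{d}'|_X$ denotes the restriction of $\mathbf{d}'$ to $X\times X$. $Y\subseteq X$ is $\mathbf{d}$-directed if $\inf_{y\in Y}\sup_{z\in F}z\mathbf{d}y=0$ for every finite $F\subseteq Y$ (so $Y\neq\emptyset$). $x\in X$ is a $\mathbf{d}$-maximum of $Y$ if $y\mathbf{d}x=0$ for all $y\in Y$ and $\inf_{y\in Y}z\mathbf{d}y\leq z\mathbf{d}x$ for all $z\in X$. $X$ is $\mathbf{d}$-$\max$-complete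 if every $\mathbf{d}$-directed subset of $X$ has a $\mathbf{d}$-maximum in $X$. $B\subseteq X$ is a $\mathbf{d}$-$\max$-basis of $X$ if every $x\in X$ is a $\mathbf{d}$-maximum of some $\mathbf{d}$-directed $Y\subseteq B$; $X$ is $\mathbf{d}$-$\max$-continuous if $X$ is a $\mathbf{d}$-$\max$-basis of itself. $X$ is a $\mathbf{d}$-$\max$-predomain if it is $\mathbf{d}$-$\max$-continuous and $\overline{\mathbf{d}}\leq\underline{\mathbf{d}}$; it is a $\mathbf{d}$-$\max$-domain if moreover it is $\mathbf{d}$-$\max$-complete. The same notions apply to $(X',\mathbf{d}')$. *)

theory Defs
  imports "HOL-Library.Extended_Nonnegative_Real"
begin

definition distance_on :: "'a set \<Rightarrow> ('a \<Rightarrow> 'a \<Rightarrow> ennreal) \<Rightarrow> bool" where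
  "distance_on X d \<longleftrightarrow> (\<forall>x\<in>X. \<forall>y\<in>X. \<forall>z\<in>X. d x z \<le> d x y + d y z)"

text \<open>
  The truncated difference is not the subtraction of type \<^typ>\<open>ennreal\<close>, for which
  \<open>\<infinity> - \<infinity> = \<infinity>\<close>: here the difference of \<open>\<infinity>\<close> and \<open>\<infinity>\<close> is \<open>0\<close>. The minimum
  exists; see \<open>pos_diff_le_iff\<close>.
\<close>

definition pos_diff :: "ennreal \<Rightarrow> ennreal \<Rightarrow> ennreal" where
  "pos_diff a b = (LEAST c. a \<le> b + c)"

lemma pos_diff_eq: "pos_diff a b = (if a \<le> b then 0 else a - b)"
  unfolding pos_diff_def
proof (rule Least_equality)
  show "a \<le> b + (if a \<le> b then 0 else a - b)"
    by (auto simp: add_diff_inverse_ennreal not_le less_imp_le)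
next
  fix c assume "a \<le> b + c"
  then show "(if a \<le> b then 0 else a - b) \<le> c"
    by (cases "b = \<infinity>") (auto simp: ennreal_minus_le_iff top_unique)
qed

lemma pos_diff_le_iff: "pos_diff a b \<le> c \<longleftrightarrow> a \<le> b + c"
proof (cases "a \<le> b")
  case True
  then show ?thesis by (auto simp: pos_diff_eq intro: order_trans)
next
  case False
  then show ?thesis
    by (cases "b = \<infinity>") (auto simp: pos_diff_eq ennreal_minus_le_iff top_unique)
qed

definition upper_hemimetric :: "'a set \<Rightarrow> ('a \<Rightarrow> 'a \<Rightarrow> ennreal) \<Rightarrow> 'a \<Rightarrow> 'a \<Rightarrow> ennreal" where
  "upper_hemimetric X d x z = (SUP y\<in>X. pos_diff (d x y) (d z y))"

definition lower_hemimetric :: "'a set \<Rightarrow> ('a \<Rightarrow> 'a \<Rightarrow> ennreal) \<Rightarrow> 'a \<Rightarrow> 'a \<Rightarrow> ennreal" where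
  "lower_hemimetric X d z y = (SUP x\<in>X. pos_diff (d x y) (d x z))"

definition d_directed :: "('a \<Rightarrow> 'a \<Rightarrow> ennreal) \<Rightarrow> 'a set \<Rightarrow> bool" where
  "d_directed d Y \<longleftrightarrow> (\<forall>F. finite F \<and> F \<subseteq> Y \<longrightarrow> (INF y\<in>Y. SUP z\<in>F. d z y) = 0)"

definition d_maximum :: "'a set \<Rightarrow> ('a \<Rightarrow> 'a \<Rightarrow> ennreal) \<Rightarrow> 'a set \<Rightarrow> 'a \<Rightarrow> bool" where
  "d_maximum X d Y x \<longleftrightarrow>
     x \<in> X \<and> (\<forall>y\<in>Y. d y x = 0) \<and> (\<forall>z\<in>X. (INF y\<in>Y. d z y) \<le> d z x)"

definition max_complete :: "'a set \<Rightarrow> ('a \<Rightarrow> 'a \<Rightarrow> ennreal) \<Rightarrow> bool" where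
  "max_complete X d \<longleftrightarrow> (\<forall>Y. Y \<subseteq> X \<and> d_directed d Y \<longrightarrow> (\<exists>x. d_maximum X d Y x))"

definition max_basis :: "'a set \<Rightarrow> ('a \<Rightarrow> 'a \<Rightarrow> ennreal) \<Rightarrow> 'a set \<Rightarrow> bool" where
  "max_basis X d B \<longleftrightarrow>
     B \<subseteq> X \<and> (\<forall>x\<in>X. \<exists>Y. Y \<subseteq> B \<and> d_directed d Y \<and> d_maximum X d Y x)"

definition max_continuous :: "'a set \<Rightarrow> ('a \<Rightarrow> 'a \<Rightarrow> ennreal) \<Rightarrow> bool" where
  "max_continuous X d \<longleftrightarrow> max_basis X d X"

definition max_predomain :: "'a set \<Rightarrow> ('a \<Rightarrow> 'a \<Rightarrow> ennreal) \<Rightarrow> bool" where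
  "max_predomain X d \<longleftrightarrow>
     max_continuous X d \<and>
     (\<forall>x\<in>X. \<forall>y\<in>X. upper_hemimetric X d x y \<le> lower_hemimetric X d x y)"

definition max_domain :: "'a set \<Rightarrow> ('a \<Rightarrow> 'a \<Rightarrow> ennreal) \<Rightarrow> bool" where
  "max_domain X d \<longleftrightarrow> max_predomain X d \<and> max_complete X d"

text \<open>
  \<open>(X', d')\<close> is a domain containing \<open>(X, d)\<close> as a basis. Since a superset of \<open>X\<close> may need more
  points than the type of \<open>X\<close> has, \<open>X'\<close> lives in its own type, and the inclusion of \<open>X\<close> in \<open>X'\<close>
  is along an injection \<open>e\<close>.
\<close>

definition max_domain_extension ::
  "('a \<Rightarrow> 'b) \<Rightarrow> 'a set \<Rightarrow> ('a \<Rightarrow> 'a \<Rightarrow> ennreal) \<Rightarrow> 'b set \<Rightarrow> ('b \<Rightarrow> 'b \<Rightarrow> ennreal) \<Rightarrow> bool" where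
  "max_domain_extension e X d X' d' \<longleftrightarrow>
     inj_on e X \<and> e ` X \<subseteq> X' \<and>
     distance_on X' d' \<and> (\<forall>x\<in>X. \<forall>y\<in>X. d' (e x) (e y) = d x y) \<and>
     max_domain X' d' \<and> max_basis X' d' (e ` X)"

end

theory Submission
  imports Defs
begin

text \<open>
  Think of \<open>d x y = 0\<close> as saying that \<open>x\<close> is way below \<open>y\<close>; the two hemimetrics then measure two
  ways in which the induced order \<open>x \<le> y\<close> can fail: \<open>upper_hemimetric\<close> through the points above
  \<open>x\<close> and \<open>y\<close>, \<open>lower_hemimetric\<close> through the points below them. The theorem is the metric form of
  the rounded ideal completion of an abstract basis.

  If \<open>X\<close> is a basis of a domain, it inherits continuity at once. It also inherits
  the comparison of the hemimetrics: shrinking the space to \<open>X\<close> can only decrease the upper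
  hemimetric, and it does not change the lower one, because a point that is way below \<open>x\<close> has,
  approximately, a point of the basis between itself and \<open>x\<close> (\<open>max_predomain_basis\<close>).

  Conversely, let \<open>X\<close> be a predomain. Directed subsets of \<open>X\<close> play the role of ideals, and
  \<open>ideal_dist d Y Z = (INF z\<in>Z. SUP y\<in>Y. d y z)\<close> is the metric form of the way-below relation of
  ideals, ``some \<open>z \<in> Z\<close> bounds all of \<open>Y\<close>''. A point \<open>x\<close> is represented by a directed set of which
  it is a maximum, and the comparison of the hemimetrics is what makes \<open>ideal_dist\<close> of two
  such representatives equal to the original distance (\<open>ideal_dist_maxima\<close>). In the completion every
  directed set \<open>Y\<close> is a maximum of its own members, so \<open>X\<close> is a basis, and a directed family
  of directed sets has its union as a maximum, so the completion is complete. Points of the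
  completion at distance zero need not be identified: nothing in the definition of a domain asks for
  it, and so all directed subsets of \<open>X\<close> can be added to \<open>X\<close> as new points.
\<close>

section \<open>Infima, directed sets and hemimetrics\<close>

lemma distance_on_triangle:
  assumes "distance_on X d" "x \<in> X" "y \<in> X" "z \<in> X"
  shows "d x z \<le> d x y + d y z"
  using assms by (simp add: distance_on_def)

lemma le_add_INF:
  fixes a c :: ennreal
  assumes "\<And>z. z \<in> Z \<Longrightarrow> a \<le> c + f z"
  shows "a \<le> c + (INF z\<in>Z. f z)"
  using assms by (simp add: pos_diff_le_iff[symmetric] le_INF_iff)

lemma d_directed_iff:
  "d_directed d Y \<longleftrightarrow>
     (\<forall>F. finite F \<and> F \<subseteq> Y \<longrightarrow> (\<forall>\<epsilon>>0. \<exists>y\<in>Y. \<forall>z\<in>F. d z y < ennreal \<epsilon>))"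
proof -
  have eq: "(INF y\<in>Y. SUP z\<in>F. d z y) = 0 \<longleftrightarrow> (\<forall>\<epsilon>>0. \<exists>y\<in>Y. \<forall>z\<in>F. d z y < ennreal \<epsilon>)"
    (is "?I = 0 \<longleftrightarrow> ?R") if "finite F" for F
  proof
    assume I: "?I = 0"
    show ?R
    proof (intro allI impI)
      fix \<epsilon> :: real assume "0 < \<epsilon>"
      then have "?I < ennreal \<epsilon>" by (simp add: I)
      then obtain y where "y \<in> Y" "(SUP z\<in>F. d z y) < ennreal \<epsilon>"
        by (auto simp: INF_less_iff)
      then show "\<exists>y\<in>Y. \<forall>z\<in>F. d z y < ennreal \<epsilon>"
        by (meson SUP_upper le_less_trans)
    qed
  next
    assume R: ?R
    have "?I \<le> 0"
    proof (rule ennreal_le_epsilon)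
      fix \<epsilon> :: real assume "0 < \<epsilon>"
      then obtain y where "y \<in> Y" "\<forall>z\<in>F. d z y < ennreal \<epsilon>" using R by blast
      then have "?I \<le> ennreal \<epsilon>"
        by (intro INF_lower2[of y] SUP_least) (auto intro: less_imp_le)
      then show "?I \<le> 0 + ennreal \<epsilon>" by simp
    qed
    then show "?I = 0" by simp
  qed
  show ?thesis unfolding d_directed_def by (intro all_cong eq) simp
qed

lemma d_directedD:
  assumes "d_directed d Y" "finite F" "F \<subseteq> Y" "0 < \<epsilon>"
  shows "\<exists>y\<in>Y. \<forall>z\<in>F. d z y < ennreal \<epsilon>"
  using assms by (simp add: d_directed_iff)

lemma d_directed_INF_eq_0:
  assumes "d_directed d Y" "y \<in> Y"
  shows "(INF z\<in>Y. d y z) = 0"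
  using assms unfolding d_directed_def by (auto dest!: spec[of _ "{y}"])

lemma d_directed_image_iff:
  assumes e: "\<forall>x\<in>X. \<forall>y\<in>X. d' (e x) (e y) = d x y" and "Y \<subseteq> X"
  shows "d_directed d' (e ` Y) \<longleftrightarrow> d_directed d Y"
proof -
  have "(INF y\<in>e ` Y. SUP z\<in>e ` F. d' z y) = (INF y\<in>Y. SUP z\<in>F. d z y)" if "F \<subseteq> Y" for F
    unfolding image_image using assms that
    by (intro INF_cong SUP_cong refl) blast
  then have "(\<forall>F. finite F \<and> F \<subseteq> Y \<longrightarrow> (INF y\<in>e ` Y. SUP z\<in>e ` F. d' z y) = 0) \<longleftrightarrow> d_directed d Y"
    unfolding d_directed_def by simp
  then show ?thesis
    unfolding d_directed_def[of d'] all_finite_subset_image by simp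
qed

lemma upper_hemimetric_le_iff:
  "upper_hemimetric X d x y \<le> c \<longleftrightarrow> (\<forall>w\<in>X. d x w \<le> d y w + c)"
  by (simp add: upper_hemimetric_def SUP_le_iff pos_diff_le_iff)

lemma lower_hemimetric_le_iff:
  "lower_hemimetric X d x y \<le> c \<longleftrightarrow> (\<forall>w\<in>X. d w y \<le> d w x + c)"
  by (simp add: lower_hemimetric_def SUP_le_iff pos_diff_le_iff)

lemma upper_le_lower_hemimetric_iff:
  "upper_hemimetric X d x y \<le> lower_hemimetric X d x y \<longleftrightarrow>
     (\<forall>c. (\<forall>w\<in>X. d w y \<le> d w x + c) \<longrightarrow> (\<forall>w\<in>X. d x w \<le> d y w + c))"
  unfolding upper_hemimetric_le_iff[symmetric] lower_hemimetric_le_iff[symmetric]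
  by (auto intro: order_trans)

section \<open>A basis of a predomain is a predomain\<close>

lemma max_predomain_basis:
  assumes tri: "distance_on X d" and pre: "max_predomain X d" and basis: "max_basis X d B"
  shows "max_predomain B d"
proof -
  have BX: "B \<subseteq> X" using basis by (simp add: max_basis_def)
  have "\<exists>Y\<subseteq>B. d_directed d Y \<and> d_maximum B d Y x" if x: "x \<in> B" for x
  proof -
    obtain Y where "Y \<subseteq> B" "d_directed d Y" "d_maximum X d Y x"
      using basis x BX unfolding max_basis_def by blast
    moreover from this have "d_maximum B d Y x"
      using x BX unfolding d_maximum_def by blast
    ultimately show ?thesis by blast
  qed
  then have "max_continuous B d" by (simp add: max_continuous_def max_basis_def)
  moreover have "upper_hemimetric B d x y \<le> lower_hemimetric B d x y"
    if x: "x \<in> B" and y: "y \<in> B" for x y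
    unfolding upper_le_lower_hemimetric_iff
  proof (intro allI impI)
    fix c assume c: "\<forall>w\<in>B. d w y \<le> d w x + c"
    obtain Y where Y: "Y \<subseteq> B" "d_maximum X d Y x"
      using basis x BX unfolding max_basis_def by blast
    have "d w y \<le> d w x + c" if w: "w \<in> X" for w
    proof -
      \<comment> \<open>Interpolate a member \<open>v\<close> of \<open>Y\<close>, to which the assumption on \<open>c\<close> applies, between \<open>w\<close> and \<open>x\<close>.\<close>
      have "d w y \<le> c + (INF v\<in>Y. d w v)"
      proof (rule le_add_INF)
        fix v assume v: "v \<in> Y"
        have "d w y \<le> d w v + d v y"
          using w v y Y(1) BX by (intro distance_on_triangle[OF tri]) auto
        also have "d v y \<le> d v x + c" using c v Y(1) by blast
        also have "d v x = 0" using Y(2) v by (simp add: d_maximum_def)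
        finally show "d w y \<le> c + d w v" by (simp add: add.commute add_mono)
      qed
      also have "\<dots> \<le> c + d w x"
        using Y(2) w by (intro add_left_mono) (auto simp: d_maximum_def)
      finally show ?thesis by (simp add: add.commute)
    qed
    moreover have "upper_hemimetric X d x y \<le> lower_hemimetric X d x y"
      using pre x y BX by (auto simp: max_predomain_def)
    ultimately have "\<forall>w\<in>X. d x w \<le> d y w + c"
      unfolding upper_le_lower_hemimetric_iff by blast
    then show "\<forall>w\<in>B. d x w \<le> d y w + c" using BX by blast
  qed
  ultimately show ?thesis by (simp add: max_predomain_def)
qed

lemma max_predomain_isometry:
  assumes e: "\<forall>x\<in>X. \<forall>y\<in>X. d' (e x) (e y) = d x y" and pre: "max_predomain (e ` X) d'"
  shows "max_predomain X d"
proof -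
  have "\<exists>Y\<subseteq>X. d_directed d Y \<and> d_maximum X d Y x" if x: "x \<in> X" for x
  proof -
    obtain Y' where "Y' \<subseteq> e ` X" "d_directed d' Y'" "d_maximum (e ` X) d' Y' (e x)"
      using pre x unfolding max_predomain_def max_continuous_def max_basis_def by blast
    then obtain Y where Y: "Y \<subseteq> X" "d_directed d' (e ` Y)" "d_maximum (e ` X) d' (e ` Y) (e x)"
      by (metis subset_image_iff)
    have "(INF y\<in>Y. d z y) \<le> d z x" if z: "z \<in> X" for z
    proof -
      have "(INF y\<in>Y. d z y) = (INF y\<in>e ` Y. d' (e z) y)"
        unfolding image_image using e Y(1) z by (intro INF_cong refl) auto
      also have "\<dots> \<le> d' (e z) (e x)" using Y(3) z by (simp add: d_maximum_def)
      finally show ?thesis using e x z by simp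
    qed
    moreover have "d y x = 0" if "y \<in> Y" for y
    proof -
      have "d' (e y) (e x) = 0" using Y(3) that by (simp add: d_maximum_def)
      moreover have "y \<in> X" using Y(1) that by blast
      ultimately show ?thesis using e x by simp
    qed
    ultimately show ?thesis
      using Y x d_directed_image_iff[where e=e, OF e Y(1)] by (auto simp: d_maximum_def)
  qed
  moreover have "upper_hemimetric X d x y \<le> lower_hemimetric X d x y"
    if "x \<in> X" "y \<in> X" for x y
  proof -
    have "upper_hemimetric (e ` X) d' (e x) (e y) \<le> lower_hemimetric (e ` X) d' (e x) (e y)"
      using pre that by (simp add: max_predomain_def)
    moreover have "upper_hemimetric (e ` X) d' (e x) (e y) = upper_hemimetric X d x y"
      "lower_hemimetric (e ` X) d' (e x) (e y) = lower_hemimetric X d x y"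
      unfolding upper_hemimetric_def lower_hemimetric_def image_image using e that
      by (auto intro!: SUP_cong)
    ultimately show ?thesis by simp
  qed
  ultimately show ?thesis
    unfolding max_predomain_def max_continuous_def max_basis_def by blast
qed

lemma max_predomain_if_extension:
  assumes "max_domain_extension e X d X' d'"
  shows "max_predomain X d"
proof (rule max_predomain_isometry)
  show "\<forall>x\<in>X. \<forall>y\<in>X. d' (e x) (e y) = d x y"
    using assms by (simp add: max_domain_extension_def)
  show "max_predomain (e ` X) d'"
    using assms max_predomain_basis
    by (auto simp: max_domain_extension_def max_domain_def)
qed

section \<open>The distance of ideals\<close>

definition ideal_dist :: "('a \<Rightarrow> 'a \<Rightarrow> ennreal) \<Rightarrow> 'a set \<Rightarrow> 'a set \<Rightarrow> ennreal" where
  "ideal_dist d Y Z = (INF z\<in>Z. SUP y\<in>Y. d y z)"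

lemma ideal_dist_le: "z \<in> Z \<Longrightarrow> ideal_dist d Y Z \<le> (SUP y\<in>Y. d y z)"
  unfolding ideal_dist_def by (rule INF_lower)

lemma SUP_dist_triangle:
  assumes tri: "distance_on X d" and "Y \<subseteq> X" "z \<in> X" "w \<in> X"
  shows "(SUP y\<in>Y. d y w) \<le> (SUP y\<in>Y. d y z) + d z w"
proof (rule SUP_least)
  fix y assume y: "y \<in> Y"
  have "d y w \<le> d y z + d z w"
    using assms(2-) y by (intro distance_on_triangle[OF tri]) auto
  also have "\<dots> \<le> (SUP y\<in>Y. d y z) + d z w"
    using y by (intro add_right_mono SUP_upper)
  finally show "d y w \<le> (SUP y\<in>Y. d y z) + d z w" .
qed

lemma ideal_dist_triangle:
  assumes tri: "distance_on X d" and sub: "Y \<subseteq> X" "Z \<subseteq> X" "W \<subseteq> X"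
  shows "ideal_dist d Y W \<le> ideal_dist d Y Z + ideal_dist d Z W"
  unfolding ideal_dist_def[of d Z W]
proof (rule le_add_INF)
  fix w assume w: "w \<in> W"
  have "ideal_dist d Y W \<le> (SUP z\<in>Z. d z w) + (INF z\<in>Z. SUP y\<in>Y. d y z)"
  proof (rule le_add_INF)
    fix z assume z: "z \<in> Z"
    have "ideal_dist d Y W \<le> (SUP y\<in>Y. d y w)" using w by (rule ideal_dist_le)
    also have "\<dots> \<le> (SUP y\<in>Y. d y z) + d z w"
      using sub z w by (intro SUP_dist_triangle[OF tri]) auto
    also have "\<dots> \<le> (SUP y\<in>Y. d y z) + (SUP z\<in>Z. d z w)"
      using z by (intro add_left_mono SUP_upper)
    finally show "ideal_dist d Y W \<le> (SUP z\<in>Z. d z w) + (SUP y\<in>Y. d y z)"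
      by (simp add: add.commute)
  qed
  then show "ideal_dist d Y W \<le> ideal_dist d Y Z + (SUP z\<in>Z. d z w)"
    by (simp add: ideal_dist_def add.commute)
qed

text \<open>
  The function \<open>w \<mapsto> d w x\<close> is the infimum of the functions \<open>w \<mapsto> d w y\<close> with \<open>y \<in> Y\<close>, so
  \<open>SUP y\<in>Y. d y z'\<close> bounds the lower hemimetric of \<open>x\<close> and \<open>z'\<close>. The hypothesis on the hemimetrics
  turns this into a bound on \<open>d x z\<close> whenever \<open>d z' z = 0\<close>.
\<close>

lemma ideal_dist_maxima:
  assumes tri: "distance_on X d" and pre: "max_predomain X d"
    and Y: "Y \<subseteq> X" "d_maximum X d Y x" and Z: "Z \<subseteq> X" "d_maximum X d Z z"
  shows "ideal_dist d Y Z = d x z"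
proof (rule antisym)
  have x: "x \<in> X" and z: "z \<in> X" using Y Z by (auto simp: d_maximum_def)
  have "ideal_dist d Y Z \<le> (INF z'\<in>Z. d x z')"
    unfolding ideal_dist_def
  proof (rule INF_superset_mono[OF order_refl])
    fix z' assume z': "z' \<in> Z"
    have "d y z' \<le> d y x + d x z'" if "y \<in> Y" for y
      using x z' that Y(1) Z(1) by (intro distance_on_triangle[OF tri]) auto
    then show "(SUP y\<in>Y. d y z') \<le> d x z'"
      using Y(2) by (intro SUP_least) (simp add: d_maximum_def)
  qed
  also have "\<dots> \<le> d x z" using Z(2) x by (simp add: d_maximum_def)
  finally show "ideal_dist d Y Z \<le> d x z" .
next
  have x: "x \<in> X" and z: "z \<in> X" using Y Z by (auto simp: d_maximum_def)
  show "d x z \<le> ideal_dist d Y Z"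
    unfolding ideal_dist_def
  proof (rule INF_greatest)
    fix z' assume z': "z' \<in> Z"
    let ?c = "SUP y\<in>Y. d y z'"
    have "d w z' \<le> d w x + ?c" if w: "w \<in> X" for w
    proof -
      have "d w z' \<le> ?c + (INF y\<in>Y. d w y)"
      proof (rule le_add_INF)
        fix y assume y: "y \<in> Y"
        have "d w z' \<le> d w y + d y z'"
          using w y z' Y(1) Z(1) by (intro distance_on_triangle[OF tri]) auto
        also have "\<dots> \<le> d w y + ?c" using y by (intro add_left_mono SUP_upper)
        finally show "d w z' \<le> ?c + d w y" by (simp add: add.commute)
      qed
      also have "\<dots> \<le> ?c + d w x"
        using Y(2) w by (intro add_left_mono) (auto simp: d_maximum_def)
      finally show ?thesis by (simp add: add.commute)
    qed
    moreover have "upper_hemimetric X d x z' \<le> lower_hemimetric X d x z'"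
      using pre x z' Z(1) by (auto simp: max_predomain_def)
    ultimately have "d x z \<le> d z' z + ?c"
      using z unfolding upper_le_lower_hemimetric_iff by blast
    also have "d z' z = 0" using Z(2) z' by (simp add: d_maximum_def)
    finally show "d x z \<le> ?c" by simp
  qed
qed

section \<open>The completion\<close>

text \<open>
  The points of \<open>X'\<close> stand for directed subsets of \<open>X\<close> through a representation \<open>r\<close>. It is onto the
  directed subsets, which will give completeness, but it need not be injective, so that \<open>e x\<close> may
  stand for a chosen directed set with maximum \<open>x\<close> and still differ from the other points that stand
  for the same set.
\<close>

locale ideal_completion =
  fixes X :: "'a set" and d :: "'a \<Rightarrow> 'a \<Rightarrow> ennreal"
    and X' :: "'b set" and r :: "'b \<Rightarrow> 'a set" and e :: "'a \<Rightarrow> 'b"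
  assumes tri: "distance_on X d"
    and pre: "max_predomain X d"
    and r_sub: "p \<in> X' \<Longrightarrow> r p \<subseteq> X"
    and r_directed: "p \<in> X' \<Longrightarrow> d_directed d (r p)"
    and r_onto: "Y \<subseteq> X \<Longrightarrow> d_directed d Y \<Longrightarrow> \<exists>p\<in>X'. r p = Y"
    and e_mem: "x \<in> X \<Longrightarrow> e x \<in> X'"
    and e_maximum: "x \<in> X \<Longrightarrow> d_maximum X d (r (e x)) x"
begin

definition compl_dist :: "'b \<Rightarrow> 'b \<Rightarrow> ennreal" where
  "compl_dist p q = ideal_dist d (r p) (r q)"

lemma compl_dist_triangle: "distance_on X' compl_dist"
  unfolding distance_on_def compl_dist_def
  by (intro ballI ideal_dist_triangle[OF tri] r_sub)

lemma compl_dist_embedding: "\<forall>x\<in>X. \<forall>y\<in>X. compl_dist (e x) (e y) = d x y"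
  unfolding compl_dist_def
  by (intro ballI ideal_dist_maxima[OF tri pre] r_sub e_mem e_maximum)

lemma compl_dist_member:
  assumes p: "p \<in> X'" and y: "y \<in> r p"
  shows "compl_dist (e y) p = 0"
proof -
  have yX: "y \<in> X" using r_sub p y by blast
  have "compl_dist (e y) p \<le> (INF z\<in>r p. d y z)"
    unfolding compl_dist_def ideal_dist_def
  proof (rule INF_superset_mono[OF order_refl])
    fix z assume z: "z \<in> r p"
    have "(SUP v\<in>r (e y). d v z) \<le> (SUP v\<in>r (e y). d v y) + d y z"
      using yX z r_sub[OF p] r_sub[OF e_mem[OF yX]] by (intro SUP_dist_triangle[OF tri]) auto
    also have "(SUP v\<in>r (e y). d v y) \<le> 0"
      using e_maximum[OF yX] by (intro SUP_least) (simp add: d_maximum_def)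
    finally show "(SUP v\<in>r (e y). d v z) \<le> d y z" by simp
  qed
  then show ?thesis
    using d_directed_INF_eq_0[OF r_directed[OF p] y] by simp
qed

text \<open>
  Two interpolations: a bound \<open>z \<in> r p\<close> of \<open>r q\<close> can be replaced by a slightly higher \<open>y \<in> r p\<close>, and
  then by a member \<open>t\<close> of \<open>r (e y)\<close> that is, up to a small error, still above \<open>z\<close>.
\<close>

lemma maximum_of_members:
  assumes p: "p \<in> X'"
  shows "d_maximum X' compl_dist (e ` r p) p"
  unfolding d_maximum_def
proof (intro conjI ballI)
  show "p \<in> X'" by (rule p)
  show "compl_dist y p = 0" if "y \<in> e ` r p" for y
    using that compl_dist_member[OF p] by auto
  fix q assume q: "q \<in> X'"
  let ?I = "INF y\<in>e ` r p. compl_dist q y"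
  show "?I \<le> compl_dist q p"
    unfolding compl_dist_def[of q p] ideal_dist_def
  proof (rule INF_greatest)
    fix z assume z: "z \<in> r p"
    have zX: "z \<in> X" using r_sub p z by blast
    let ?S = "SUP w\<in>r q. d w z"
    have "?I \<le> ?S + (INF y\<in>r p. d z y)"
    proof (rule le_add_INF)
      fix y assume y: "y \<in> r p"
      have yX: "y \<in> X" using r_sub p y by blast
      have "?I \<le> compl_dist q (e y)" using y by (intro INF_lower imageI)
      also have "\<dots> \<le> ?S + (INF t\<in>r (e y). d z t)"
      proof (rule le_add_INF)
        fix t assume t: "t \<in> r (e y)"
        have "compl_dist q (e y) \<le> (SUP w\<in>r q. d w t)"
          unfolding compl_dist_def using t by (rule ideal_dist_le)
        also have "\<dots> \<le> ?S + d z t"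
          using t zX r_sub[OF q] r_sub[OF e_mem[OF yX]]
          by (intro SUP_dist_triangle[OF tri]) auto
        finally show "compl_dist q (e y) \<le> ?S + d z t" .
      qed
      also have "\<dots> \<le> ?S + d z y"
        using e_maximum[OF yX] zX by (intro add_left_mono) (simp add: d_maximum_def)
      finally show "?I \<le> ?S + d z y" .
    qed
    then show "?I \<le> ?S"
      using d_directed_INF_eq_0[OF r_directed[OF p] z] by simp
  qed
qed

lemma max_basis_embedding: "max_basis X' compl_dist (e ` X)"
  unfolding max_basis_def
proof (intro conjI ballI)
  show "e ` X \<subseteq> X'" using e_mem by blast
  fix p assume p: "p \<in> X'"
  have "d_directed compl_dist (e ` r p)"
    using d_directed_image_iff[where e=e, OF compl_dist_embedding r_sub[OF p]] r_directed[OF p] by simp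
  then show "\<exists>Y\<subseteq>e ` X. d_directed compl_dist Y \<and> d_maximum X' compl_dist Y p"
    using maximum_of_members[OF p] r_sub[OF p] by blast
qed

text \<open>
  A bound \<open>c\<close> on the lower hemimetric is tested only at the points \<open>e y\<close> with \<open>y \<in> r p\<close>, which are at
  distance zero from \<open>p\<close>: it shows that members of \<open>r p\<close> are, up to arbitrarily small errors, within
  \<open>c\<close> of members of \<open>r q\<close>, so that whatever bounds \<open>r q\<close> bounds \<open>r p\<close> up to \<open>c\<close>.
\<close>

lemma compl_hemimetrics:
  assumes p: "p \<in> X'" and q: "q \<in> X'"
  shows "upper_hemimetric X' compl_dist p q \<le> lower_hemimetric X' compl_dist p q"
  unfolding upper_le_lower_hemimetric_iff
proof (intro allI impI ballI)
  fix c u assume c: "\<forall>w\<in>X'. compl_dist w q \<le> compl_dist w p + c" and u: "u \<in> X'"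
  have near: "(INF z\<in>r q. d y z) \<le> c" (is "?I \<le> c") if y: "y \<in> r p" for y
  proof -
    have yX: "y \<in> X" using r_sub p y by blast
    have "?I \<le> c + (INF y'\<in>r p. d y y')"
    proof (rule le_add_INF)
      fix y' assume y': "y' \<in> r p"
      have y'X: "y' \<in> X" using r_sub p y' by blast
      \<comment> \<open>The hypothesis on \<open>c\<close> speaks of \<open>r (e y')\<close>, so pass from \<open>y\<close> to the members of that set.\<close>
      have "compl_dist (e y') q \<le> c"
        using c e_mem[OF y'X] compl_dist_member[OF p y'] by (metis add_0)
      moreover have "?I \<le> compl_dist (e y') q + (INF t\<in>r (e y'). d y t)"
      proof (rule le_add_INF)
        fix t assume t: "t \<in> r (e y')"
        have "?I \<le> d y t + (INF z\<in>r q. SUP t\<in>r (e y'). d t z)"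
        proof (rule le_add_INF)
          fix z assume z: "z \<in> r q"
          have "?I \<le> d y z" using z by (rule INF_lower)
          also have "\<dots> \<le> d y t + d t z"
            using yX t z r_sub[OF q] r_sub[OF e_mem[OF y'X]]
            by (intro distance_on_triangle[OF tri]) auto
          also have "\<dots> \<le> d y t + (SUP t\<in>r (e y'). d t z)"
            using t by (intro add_left_mono SUP_upper)
          finally show "?I \<le> d y t + (SUP t\<in>r (e y'). d t z)" .
        qed
        then show "?I \<le> compl_dist (e y') q + d y t"
          by (simp add: compl_dist_def ideal_dist_def add.commute)
      qed
      moreover have "(INF t\<in>r (e y'). d y t) \<le> d y y'"
        using e_maximum[OF y'X] yX by (simp add: d_maximum_def)
      ultimately show "?I \<le> c + d y y'" by (meson add_mono order_trans)
    qed
    then show ?thesis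
      using d_directed_INF_eq_0[OF r_directed[OF p] y] by simp
  qed
  have "compl_dist p u \<le> c + (INF w\<in>r u. SUP z\<in>r q. d z w)"
  proof (rule le_add_INF)
    fix w assume w: "w \<in> r u"
    let ?S = "SUP z\<in>r q. d z w"
    have "compl_dist p u \<le> (SUP y\<in>r p. d y w)"
      unfolding compl_dist_def using w by (rule ideal_dist_le)
    also have "\<dots> \<le> ?S + c"
    proof (rule SUP_least)
      fix y assume y: "y \<in> r p"
      have "d y w \<le> ?S + (INF z\<in>r q. d y z)"
      proof (rule le_add_INF)
        fix z assume z: "z \<in> r q"
        have "d y w \<le> d y z + d z w"
          using y z w r_sub[OF p] r_sub[OF q] r_sub[OF u]
          by (intro distance_on_triangle[OF tri]) auto
        also have "\<dots> \<le> d y z + ?S" using z by (intro add_left_mono SUP_upper)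
        finally show "d y w \<le> ?S + d y z" by (simp add: add.commute)
      qed
      also have "\<dots> \<le> ?S + c" using near[OF y] by (rule add_left_mono)
      finally show "d y w \<le> ?S + c" .
    qed
    finally show "compl_dist p u \<le> c + ?S" by (simp add: add.commute)
  qed
  then show "compl_dist p u \<le> compl_dist q u + c"
    by (simp add: compl_dist_def ideal_dist_def add.commute)
qed

text \<open>
  Finitely many members \<open>f\<close> of the union lie in sets \<open>r (g f)\<close>; a single \<open>p \<in> P\<close> is nearly above all
  these \<open>g f\<close>, so each \<open>f\<close> is close to some \<open>h f \<in> r p\<close>, and since \<open>r p\<close> is directed the points \<open>h f\<close>
  have a common approximate upper bound in it.
\<close>

lemma d_directed_Union:
  assumes P: "P \<subseteq> X'" and dir: "d_directed compl_dist P"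
  shows "d_directed d (\<Union>p\<in>P. r p)"
  unfolding d_directed_iff
proof (intro allI impI)
  fix F and \<epsilon> :: real
  assume F: "finite F \<and> F \<subseteq> (\<Union>p\<in>P. r p)" and "0 < \<epsilon>"
  then have half: "0 < \<epsilon> / 2" by simp
  from F obtain g where g: "\<And>f. f \<in> F \<Longrightarrow> g f \<in> P \<and> f \<in> r (g f)"
    by (metis UN_E subsetD)
  then have gF: "finite (g ` F)" "g ` F \<subseteq> P" using F by auto
  then obtain p where p: "p \<in> P" "\<forall>v\<in>g ` F. compl_dist v p < ennreal (\<epsilon> / 2)"
    using d_directedD[OF dir gF half] by blast
  have "\<exists>y\<in>r p. d f y < ennreal (\<epsilon> / 2)" if f: "f \<in> F" for f
  proof -
    from p(2) f obtain y where "y \<in> r p" "(SUP v\<in>r (g f). d v y) < ennreal (\<epsilon> / 2)"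
      unfolding compl_dist_def ideal_dist_def INF_less_iff by blast
    then show ?thesis using g[OF f] by (meson SUP_upper le_less_trans)
  qed
  then obtain h where h: "\<And>f. f \<in> F \<Longrightarrow> h f \<in> r p \<and> d f (h f) < ennreal (\<epsilon> / 2)" by metis
  then have hF: "finite (h ` F)" "h ` F \<subseteq> r p" using F by auto
  then obtain y where y: "y \<in> r p" "\<forall>v\<in>h ` F. d v y < ennreal (\<epsilon> / 2)"
    using d_directedD[OF r_directed hF half] p(1) P by (meson subsetD)
  have "d f y < ennreal \<epsilon>" if f: "f \<in> F" for f
  proof -
    have "f \<in> X" "h f \<in> X" "y \<in> X" using g h f y(1) p(1) P r_sub by blast+
    then have "d f y \<le> d f (h f) + d (h f) y" by (intro distance_on_triangle[OF tri]) auto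
    also have "\<dots> < ennreal (\<epsilon> / 2) + ennreal (\<epsilon> / 2)"
      using h f y(2) by (intro add_strict_mono) auto
    also have "\<dots> = ennreal \<epsilon>" using \<open>0 < \<epsilon>\<close> by (simp flip: ennreal_plus)
    finally show ?thesis .
  qed
  then show "\<exists>y\<in>\<Union>p\<in>P. r p. \<forall>f\<in>F. d f y < ennreal \<epsilon>" using y(1) p(1) by blast
qed

lemma max_complete_completion: "max_complete X' compl_dist"
  unfolding max_complete_def
proof (intro allI impI)
  fix P assume P: "P \<subseteq> X' \<and> d_directed compl_dist P"
  then have "(\<Union>p\<in>P. r p) \<subseteq> X" using r_sub by blast
  then obtain s where s: "s \<in> X'" "r s = (\<Union>p\<in>P. r p)"
    using r_onto[of "\<Union>p\<in>P. r p"] d_directed_Union[of P] P by auto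
  have "d_maximum X' compl_dist P s"
    unfolding d_maximum_def
  proof (intro conjI ballI)
    show "s \<in> X'" by (rule s(1))
  next
    fix p assume p: "p \<in> P"
    have "compl_dist p s \<le> (INF p'\<in>P. compl_dist p p')"
      unfolding compl_dist_def ideal_dist_def s(2)
      by (intro INF_greatest INF_superset_mono) auto
    then show "compl_dist p s = 0"
      using d_directed_INF_eq_0 P p by (metis le_zero_eq)
  next
    fix q assume "q \<in> X'"
    show "(INF p\<in>P. compl_dist q p) \<le> compl_dist q s"
      unfolding compl_dist_def[of q s] ideal_dist_def s(2)
    proof (rule INF_greatest)
      fix y assume "y \<in> (\<Union>p\<in>P. r p)"
      then obtain p where "p \<in> P" "y \<in> r p" by blast
      then show "(INF p\<in>P. compl_dist q p) \<le> (SUP w\<in>r q. d w y)"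
        by (intro INF_lower2[of p]) (auto simp: compl_dist_def intro: ideal_dist_le)
    qed
  qed
  then show "\<exists>x. d_maximum X' compl_dist P x" ..
qed

lemma max_domain_completion: "max_domain X' compl_dist"
proof -
  have "max_continuous X' compl_dist"
    using max_basis_embedding unfolding max_continuous_def max_basis_def
    by (meson order_refl order_trans)
  then show ?thesis
    using compl_hemimetrics max_complete_completion
    by (simp add: max_domain_def max_predomain_def)
qed

end

section \<open>Predomains are the bases of domains\<close>

lemma extension_if_max_predomain:
  assumes tri: "distance_on X d" and pre: "max_predomain X d"
  shows "\<exists>(X' :: ('a + 'a set) set) d'. max_domain_extension (Inl :: 'a \<Rightarrow> _) X d X' d'"
proof -
  have "\<forall>x\<in>X. \<exists>Y. Y \<subseteq> X \<and> d_directed d Y \<and> d_maximum X d Y x"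
    using pre unfolding max_predomain_def max_continuous_def max_basis_def by blast
  then obtain R where R: "\<And>x. x \<in> X \<Longrightarrow> R x \<subseteq> X \<and> d_directed d (R x) \<and> d_maximum X d (R x) x"
    by metis
  define X' where "X' = Inl ` X \<union> Inr ` {Y. Y \<subseteq> X \<and> d_directed d Y}"
  define r where "r = case_sum R id"
  interpret ideal_completion X d X' r Inl
  proof
    show "\<exists>p\<in>X'. r p = Y" if "Y \<subseteq> X" "d_directed d Y" for Y
      using that by (intro bexI[of _ "Inr Y"]) (auto simp: X'_def r_def)
    show "r p \<subseteq> X" "d_directed d (r p)" if "p \<in> X'" for p
      using that R by (fastforce simp: X'_def r_def)+
  qed (use tri pre R in \<open>simp_all add: X'_def r_def\<close>)
  have "max_domain_extension Inl X d X' compl_dist"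
    unfolding max_domain_extension_def
    using e_mem compl_dist_triangle compl_dist_embedding max_domain_completion max_basis_embedding
    by auto
  then show ?thesis by blast
qed

theorem corollary4p8:
  fixes X :: "'a set" and d :: "'a \<Rightarrow> 'a \<Rightarrow> ennreal"
  assumes "distance_on X d"
  shows "(max_predomain X d \<longleftrightarrow>
            (\<exists>(X' :: ('a + 'a set) set) d'. max_domain_extension Inl X d X' d')) \<and>
         ((\<exists>(e :: 'a \<Rightarrow> 'b) X' d'. max_domain_extension e X d X' d') \<longrightarrow> max_predomain X d)"
proof (intro conjI iffI impI)
  assume "max_predomain X d"
  with assms show "\<exists>(X' :: ('a + 'a set) set) d'. max_domain_extension Inl X d X' d'"
    by (rule extension_if_max_predomain)
qed (auto intro: max_predomain_if_extension)

end
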